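(* Let $n\ge 2$ and consider a linear ordinary differential equation in normal form $$y^{(n)}+A_n^2\,y^{(n-2)}+\dots+A_n^j\,y^{(n-j)}+\dots+A_n^n\,y=0,$$ with corresponding second-order source equation $y''+\mathfrak{q}\,y=0$, where $\mathfrak{q}=A_n^2/\binom{n+1}{3}$. This equation is iterative if and only if it has $n$ linearly independent solutions of the form $$y_k=u^{\,n-1-k}\,v^{\,k},\qquad k=0,\dots,n-1,$$ where $u$ and $v$ are two linearly independent solutions of the source equation $y''+\mathfrak{q}\,y=0$.
   Context: All functions are smooth functions of $x$ and all considerations are local (on sufficiently small intervals). Superscripts on $A_n^j$ are indices, not powers. Two equations differing by multiplication by a nowhere vanishing function of $x$ are regarded as the same equation. Iterative equations: let $r$ (nowhere zero) and $s$ be smooth functions of $x$, and let $\Psi=r\frac{d}{dx}+s$, so $\Psi[y]=ry'+sy$. Put $\Psi^0=I$ (identity) and $\Psi^n[y]=\Psi^{n-1}(\Psi[y])$ for $n\ge1$. A linear equation of order $n$ is called iterative if it is of the form $\Psi^n[y]=0$ for some such $r,s$. The convention $0^0$: $u^0$ and $v^0$ denote the constant function $1$. *)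

theory Defs
  imports "HOL-Analysis.Analysis"
begin

text \<open>
  Functions of \<open>x\<close> are real-valued and represented by total functions of type
  \<open>real \<Rightarrow> real\<close>, of which only the values on the interval under consideration matter.
\<close>

definition open_interval :: "real set \<Rightarrow> bool" where
  "open_interval J \<longleftrightarrow> open J \<and> is_interval J \<and> J \<noteq> {}"

text \<open>Only used for open \<open>J\<close>, where the iterated \<^const>\<open>deriv\<close> on \<open>J\<close> depends only on \<open>f\<close> on \<open>J\<close>.\<close>

definition smooth_on :: "real set \<Rightarrow> (real \<Rightarrow> real) \<Rightarrow> bool" where
  "smooth_on J f \<longleftrightarrow> (\<forall>k. \<forall>x\<in>J. (deriv ^^ k) f differentiable (at x))"

definition lin_indep_on :: "real set \<Rightarrow> nat \<Rightarrow> (nat \<Rightarrow> real \<Rightarrow> real) \<Rightarrow> bool" where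
  "lin_indep_on J m f \<longleftrightarrow>
     (\<forall>c :: nat \<Rightarrow> real. (\<forall>x\<in>J. (\<Sum>k<m. c k * f k x) = 0) \<longrightarrow> (\<forall>k<m. c k = 0))"

text \<open>
  Linear differential equations \<open>L[y] = 0\<close> are represented by their left-hand side, an operator
  \<open>L\<close> on functions.
\<close>

definition solution_on ::
  "real set \<Rightarrow> ((real \<Rightarrow> real) \<Rightarrow> real \<Rightarrow> real) \<Rightarrow> (real \<Rightarrow> real) \<Rightarrow> bool" where
  "solution_on J L y \<longleftrightarrow> smooth_on J y \<and> (\<forall>x\<in>J. L y x = 0)"

text \<open>Two equations are identified if they differ by a nowhere vanishing factor.\<close>

definition same_equation_on ::
  "real set \<Rightarrow> ((real \<Rightarrow> real) \<Rightarrow> real \<Rightarrow> real) \<Rightarrow> ((real \<Rightarrow> real) \<Rightarrow> real \<Rightarrow> real) \<Rightarrow> bool" where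
  "same_equation_on J L M \<longleftrightarrow>
     (\<exists>c. smooth_on J c \<and> (\<forall>x\<in>J. c x \<noteq> 0) \<and>
          (\<forall>y. smooth_on J y \<longrightarrow> (\<forall>x\<in>J. L y x = c x * M y x)))"

definition Psi :: "(real \<Rightarrow> real) \<Rightarrow> (real \<Rightarrow> real) \<Rightarrow> (real \<Rightarrow> real) \<Rightarrow> real \<Rightarrow> real" where
  "Psi r s y = (\<lambda>x. r x * deriv y x + s x * y x)"

definition iterative_on ::
  "real set \<Rightarrow> nat \<Rightarrow> ((real \<Rightarrow> real) \<Rightarrow> real \<Rightarrow> real) \<Rightarrow> bool" where
  "iterative_on J n L \<longleftrightarrow>
     (\<exists>r s. smooth_on J r \<and> smooth_on J s \<and> (\<forall>x\<in>J. r x \<noteq> 0) \<and>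
            same_equation_on J (Psi r s ^^ n) L)"

text \<open>The coefficient of \<open>y\<close>'s derivative of order \<open>n - j\<close> is \<open>A j\<close>, for \<open>2 \<le> j \<le> n\<close>.\<close>

definition normal_form ::
  "nat \<Rightarrow> (nat \<Rightarrow> real \<Rightarrow> real) \<Rightarrow> (real \<Rightarrow> real) \<Rightarrow> real \<Rightarrow> real" where
  "normal_form n A y = (\<lambda>x. (deriv ^^ n) y x + (\<Sum>j=2..n. A j x * (deriv ^^ (n - j)) y x))"

definition source_coeff :: "nat \<Rightarrow> (nat \<Rightarrow> real \<Rightarrow> real) \<Rightarrow> real \<Rightarrow> real" where
  "source_coeff n A = (\<lambda>x. A 2 x / real ((n + 1) choose 3))"

definition source_equation ::
  "nat \<Rightarrow> (nat \<Rightarrow> real \<Rightarrow> real) \<Rightarrow> (real \<Rightarrow> real) \<Rightarrow> real \<Rightarrow> real" where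
  "source_equation n A y = (\<lambda>x. (deriv ^^ 2) y x + source_coeff n A x * y x)"

definition has_power_solutions_on ::
  "real set \<Rightarrow> nat \<Rightarrow> (nat \<Rightarrow> real \<Rightarrow> real) \<Rightarrow> bool" where
  "has_power_solutions_on J n A \<longleftrightarrow>
     (\<exists>u v. solution_on J (source_equation n A) u \<and> solution_on J (source_equation n A) v \<and>
            lin_indep_on J 2 (\<lambda>k. if k = 0 then u else v) \<and>
            (\<forall>k<n. solution_on J (normal_form n A) (\<lambda>x. u x ^ (n - 1 - k) * v x ^ k)) \<and>
            lin_indep_on J n (\<lambda>k x. u x ^ (n - 1 - k) * v x ^ k))"

end

theory Submission
  imports Defs
begin

text \<open>
  Everything rests on one computation. Let \<open>\<Psi> = r d/dx + s\<close> with \<open>r\<close> nowhere zero, choose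
  \<open>\<phi>\<close> with \<open>\<Psi>[\<phi>] = 0\<close> and \<open>t\<close> with \<open>t' = 1/r\<close>. Then \<open>\<Psi>[\<phi> g] = \<phi> r g'\<close>, so in the gauge \<open>\<phi>\<close> and the
  coordinate \<open>t\<close> the operator \<open>\<Psi>\<close> is plain differentiation, and the solutions of \<open>\<Psi>\<^sup>n[y] = 0\<close> are
  \<open>\<phi> t\<^sup>k\<close> for \<open>k < n\<close> (\<open>Psi_funpow_gauged_power\<close>). Whenever \<open>\<phi> = u\<^sup>n\<^sup>-\<^sup>1\<close> and \<open>t = v/u\<close>, these are the
  products \<open>u\<^sup>n\<^sup>-\<^sup>1\<^sup>-\<^sup>k v\<^sup>k\<close>. The second ingredient is that each of the operators \<open>d/dx\<close> and
  \<open>\<Psi>\<close> is a first-order expression in the other, so that powers of either can be expanded in powers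
  of the other (\<open>Psi_funpow_expansion\<close>).

  Suppose the equation is iterative. Expanding \<open>\<Psi>\<^sup>n\<close> in powers of \<open>d/dx\<close> and comparing the coefficients
  of orders \<open>n\<close>, \<open>n - 1\<close> and \<open>n - 2\<close> with the normal form gives \<open>s = -(n-1) r'/2\<close> and
  \<open>q = (r'/(2r))\<^sup>2 - r''/(2r)\<close> (\<open>iterative_coefficients\<close>). The first identity
  makes \<open>\<phi> = u\<^sup>n\<^sup>-\<^sup>1\<close> a valid choice for any nonzero \<open>u\<close> with \<open>u' = u r'/(2r)\<close>, that is, for the
  constant multiples of the square root of \<open>\<bar>r\<bar>\<close>; the second says that this \<open>u\<close> and \<open>v = u t\<close> solve \<open>y'' + q y = 0\<close>.

  Conversely, let \<open>u\<close>, \<open>v\<close> be given. On a short interval around \<open>x0\<close>, a nontrivial combination \<open>f\<close> of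
  \<open>u\<close> and \<open>v\<close> with \<open>f'(x0) = 0\<close> stays close to its initial value and therefore has no zeros
  (\<open>solution_close_to_initial_value\<close>); how short depends on a bound for \<open>q\<close> alone. With a second,
  independent combination \<open>g\<close> and the constant Wronskian \<open>W\<close> of \<open>f\<close> and \<open>g\<close>, put \<open>t = g/f\<close>,
  \<open>\<phi> = f\<^sup>n\<^sup>-\<^sup>1\<close> and choose \<open>r = f\<^sup>2/W\<close> and \<open>s\<close> with \<open>\<Psi>[\<phi>] = 0\<close>. Write the given operator as
  \<open>\<Sum>j\<le>n. b\<^sub>j \<Psi>\<^sup>j\<close>. For fixed \<open>x\<close>, the images of \<open>\<phi> (t - t(x))\<^sup>k\<close> under \<open>\<Psi>\<^sup>j\<close> with \<open>j \<noteq> k\<close> vanish at \<open>x\<close>,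
  and for \<open>k < n\<close> this function is a solution; hence \<open>b\<^sub>k(x) = 0\<close>. Only the term with \<open>j = n\<close> survives
  (\<open>iterative_if_gauged_power_solutions\<close>).
\<close>

section \<open>Smooth functions on an open set\<close>

lemma smooth_on_differentiable:
  "smooth_on J f \<Longrightarrow> x \<in> J \<Longrightarrow> f differentiable (at x)"
  by (metis funpow_0 smooth_on_def)

lemma smooth_on_DERIV:
  "smooth_on J f \<Longrightarrow> x \<in> J \<Longrightarrow> (f has_real_derivative deriv f x) (at x)"
  using DERIV_deriv_iff_real_differentiable smooth_on_differentiable by blast

lemma smooth_on_deriv: "smooth_on J f \<Longrightarrow> smooth_on J (deriv f)"
  unfolding smooth_on_def by (metis comp_apply funpow_Suc_right)

lemma smooth_on_deriv_funpow: "smooth_on J f \<Longrightarrow> smooth_on J ((deriv ^^ k) f)"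
  by (induction k) (auto intro: smooth_on_deriv)

lemma deriv_eq_on_open:
  assumes "open J" "x \<in> J" "\<And>z. z \<in> J \<Longrightarrow> f z = g z"
  shows "deriv f x = deriv g (x::real)"
  by (rule deriv_cong_ev[OF eventually_mono[OF eventually_nhds_in_open[OF assms(1,2)]]])
     (use assms in auto)

lemma deriv_funpow_eq_on_open:
  assumes "open J" "x \<in> J" "\<And>z. z \<in> J \<Longrightarrow> f z = g z"
  shows "(deriv ^^ k) f x = (deriv ^^ k) g (x::real)"
  by (rule higher_deriv_cong_ev[OF eventually_mono[OF eventually_nhds_in_open[OF assms(1,2)]]])
     (use assms in auto)

text \<open>
  Closure of the smooth functions under algebraic operations is proved by induction on the order
  of differentiability, because the derivative of a product or of a reciprocal is again built from
  products and reciprocals, whose differentiability is known only to one order less.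
\<close>

fun differentiable_times_on :: "nat \<Rightarrow> real set \<Rightarrow> (real \<Rightarrow> real) \<Rightarrow> bool" where
  "differentiable_times_on 0 J f \<longleftrightarrow> True"
| "differentiable_times_on (Suc k) J f \<longleftrightarrow>
     (\<forall>x\<in>J. f differentiable (at x)) \<and> differentiable_times_on k J (deriv f)"

lemma differentiable_times_on_iff:
  "differentiable_times_on k J f \<longleftrightarrow> (\<forall>i<k. \<forall>x\<in>J. (deriv ^^ i) f differentiable (at x))"
proof (induction k arbitrary: f)
  case (Suc k)
  show ?case
    unfolding differentiable_times_on.simps Suc.IH less_Suc_eq_0_disj
    by (auto simp: funpow_Suc_right simp del: funpow.simps(2))
qed simp

lemma smooth_on_iff_times: "smooth_on J f \<longleftrightarrow> (\<forall>k. differentiable_times_on k J f)"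
  unfolding smooth_on_def differentiable_times_on_iff by blast

lemma differentiable_times_on_cong:
  assumes "open J" "\<And>x. x \<in> J \<Longrightarrow> f x = g x" "differentiable_times_on k J f"
  shows "differentiable_times_on k J g"
proof -
  have "(deriv ^^ i) g differentiable (at x)"
    if "x \<in> J" and d: "(deriv ^^ i) f differentiable (at x)" for x i
  proof -
    obtain D where "((deriv ^^ i) f has_real_derivative D) (at x)"
      using d real_differentiable_def by blast
    then have "((deriv ^^ i) g has_real_derivative D) (at x)"
      by (rule has_field_derivative_transform_within_open[OF _ assms(1) that(1)])
         (use assms in \<open>auto intro!: deriv_funpow_eq_on_open\<close>)
    then show ?thesis using real_differentiable_def by blast
  qed
  then show ?thesis using assms(3) unfolding differentiable_times_on_iff by blast
qed

lemma smooth_on_cong: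
  assumes "open J" "smooth_on J f" "\<And>x. x \<in> J \<Longrightarrow> f x = g x"
  shows "smooth_on J g"
  using differentiable_times_on_cong[of J f g] assms unfolding smooth_on_iff_times by blast

lemma differentiable_times_on_less:
  "differentiable_times_on (Suc k) J f \<Longrightarrow> differentiable_times_on k J f"
  unfolding differentiable_times_on_iff by auto

lemma differentiable_times_on_SucI:
  assumes "open J" "\<And>x. x \<in> J \<Longrightarrow> (f has_real_derivative f' x) (at x)"
    and "differentiable_times_on k J f'"
  shows "differentiable_times_on (Suc k) J f"
proof -
  have "differentiable_times_on k J (deriv f)"
    by (rule differentiable_times_on_cong[OF assms(1) _ assms(3)])
       (use DERIV_imp_deriv[OF assms(2)] in auto)
  then show ?thesis using assms(2) real_differentiable_def by auto
qed

lemma differentiable_times_on_SucD: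
  assumes "differentiable_times_on (Suc k) J f" "x \<in> J"
  shows "(f has_real_derivative deriv f x) (at x)"
  using assms DERIV_deriv_iff_real_differentiable by auto

lemma differentiable_times_on_add:
  assumes "open J"
  shows "differentiable_times_on k J f \<Longrightarrow> differentiable_times_on k J g \<Longrightarrow>
    differentiable_times_on k J (\<lambda>x. f x + g x)"
proof (induction k arbitrary: f g)
  case (Suc k)
  show ?case
    by (rule differentiable_times_on_SucI[OF assms,
          where f' = "\<lambda>x. deriv f x + deriv g x"])
       (use Suc in \<open>auto intro!: derivative_eq_intros intro: differentiable_times_on_SucD\<close>)
qed simp

lemma differentiable_times_on_mult:
  assumes "open J"
  shows "differentiable_times_on k J f \<Longrightarrow> differentiable_times_on k J g \<Longrightarrow>
    differentiable_times_on k J (\<lambda>x. f x * g x)"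
proof (induction k arbitrary: f g)
  case (Suc k)
  show ?case
  proof (rule differentiable_times_on_SucI[OF assms,
      where f' = "\<lambda>x. deriv f x * g x + f x * deriv g x"])
    show "differentiable_times_on k J (\<lambda>x. deriv f x * g x + f x * deriv g x)"
      using Suc differentiable_times_on_less
      by (intro differentiable_times_on_add[OF assms] Suc.IH) auto
  qed (use Suc.prems[THEN differentiable_times_on_SucD] in
       \<open>auto intro!: derivative_eq_intros\<close>)
qed simp

lemma differentiable_times_on_const: "differentiable_times_on k J (\<lambda>x. c)"
  by (induction k arbitrary: c) auto

lemma differentiable_times_on_inverse:
  assumes "open J" "smooth_on J f" "\<And>x. x \<in> J \<Longrightarrow> f x \<noteq> 0"
  shows "differentiable_times_on k J (\<lambda>x. inverse (f x))"
proof (induction k)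
  case (Suc k)
  show ?case
  proof (rule differentiable_times_on_SucI[OF assms(1),
      where f' = "\<lambda>x. (-1) * deriv f x * (inverse (f x) * inverse (f x))"])
    show "differentiable_times_on k J
        (\<lambda>x. (-1) * deriv f x * (inverse (f x) * inverse (f x)))"
      using Suc smooth_on_deriv[OF assms(2)] unfolding smooth_on_iff_times
      by (intro differentiable_times_on_mult[OF assms(1)] differentiable_times_on_const) auto
    show "((\<lambda>x. inverse (f x)) has_real_derivative
        (-1) * deriv f x * (inverse (f x) * inverse (f x))) (at x)" if "x \<in> J" for x
      using assms that smooth_on_DERIV by (auto intro!: derivative_eq_intros)
  qed
qed simp

lemma smooth_on_const: "smooth_on J (\<lambda>x. c)"
  by (simp add: smooth_on_iff_times differentiable_times_on_const)

lemma smooth_on_add: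
  "open J \<Longrightarrow> smooth_on J f \<Longrightarrow> smooth_on J g \<Longrightarrow> smooth_on J (\<lambda>x. f x + g x)"
  by (simp add: smooth_on_iff_times differentiable_times_on_add)

lemma smooth_on_mult:
  "open J \<Longrightarrow> smooth_on J f \<Longrightarrow> smooth_on J g \<Longrightarrow> smooth_on J (\<lambda>x. f x * g x)"
  by (simp add: smooth_on_iff_times differentiable_times_on_mult)

lemma smooth_on_inverse:
  "open J \<Longrightarrow> smooth_on J f \<Longrightarrow> (\<And>x. x \<in> J \<Longrightarrow> f x \<noteq> 0) \<Longrightarrow> smooth_on J (\<lambda>x. inverse (f x))"
  using differentiable_times_on_inverse by (auto simp: smooth_on_iff_times)

lemma smooth_on_diff:
  assumes "open J" "smooth_on J f" "smooth_on J g"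
  shows "smooth_on J (\<lambda>x. f x - g x)"
  using smooth_on_add[OF assms(1,2) smooth_on_mult[OF assms(1) smooth_on_const[of J "-1"] assms(3)]]
  by simp

lemma smooth_on_divide:
  assumes "open J" "smooth_on J f" "smooth_on J g" "\<And>x. x \<in> J \<Longrightarrow> g x \<noteq> 0"
  shows "smooth_on J (\<lambda>x. f x / g x)"
  using smooth_on_mult[OF assms(1,2) smooth_on_inverse[OF assms(1,3,4)]]
  by (simp add: divide_inverse)

lemma smooth_on_power: "open J \<Longrightarrow> smooth_on J f \<Longrightarrow> smooth_on J (\<lambda>x. f x ^ k)"
  by (induction k) (auto intro: smooth_on_const smooth_on_mult)

lemma smooth_on_sum:
  "open J \<Longrightarrow> (\<And>i. i \<in> S \<Longrightarrow> smooth_on J (f i)) \<Longrightarrow> smooth_on J (\<lambda>x. \<Sum>i\<in>S. f i x)"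
  by (induction S rule: infinite_finite_induct) (auto intro: smooth_on_const smooth_on_add)

lemma smooth_on_primitive:
  assumes "open J" "\<And>x. x \<in> J \<Longrightarrow> (F has_real_derivative f x) (at x)" "smooth_on J f"
  shows "smooth_on J F"
  unfolding smooth_on_iff_times
proof
  fix k
  show "differentiable_times_on k J F"
    using differentiable_times_on_SucI[OF assms(1,2)] assms(3)
    by (cases k) (auto simp: smooth_on_iff_times)
qed

lemma smooth_on_ident: "open J \<Longrightarrow> smooth_on J (\<lambda>x. x)"
  by (rule smooth_on_primitive[OF _ _ smooth_on_const[of J 1]]) auto

text \<open>
  Bootstrapping: the differential equation makes \<open>y'\<close> as many times differentiable as \<open>y\<close> is, so
  \<open>y\<close> gains one order with each step.
\<close>

lemma smooth_on_linear_ode: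
  assumes "open J" "\<And>x. x \<in> J \<Longrightarrow> (y has_real_derivative a x * y x) (at x)" "smooth_on J a"
  shows "smooth_on J y"
  unfolding smooth_on_iff_times
proof
  fix k
  show "differentiable_times_on k J y"
  proof (induction k)
    case (Suc k)
    then show ?case
      using differentiable_times_on_SucI[OF assms(1,2)] differentiable_times_on_mult[OF assms(1)]
        assms(3) by (simp add: smooth_on_iff_times del: differentiable_times_on.simps)
  qed simp
qed

lemmas smooth_on_intros =
  smooth_on_const smooth_on_add smooth_on_diff smooth_on_mult smooth_on_power smooth_on_sum
  smooth_on_deriv

lemma deriv_sum_mult:
  assumes "\<And>i. i \<in> S \<Longrightarrow> smooth_on J (a i)" "\<And>i. i \<in> S \<Longrightarrow> smooth_on J (f i)" "x \<in> J"
  shows "deriv (\<lambda>x. \<Sum>i\<in>S. a i x * f i x) x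
    = (\<Sum>i\<in>S. deriv (a i) x * f i x + a i x * deriv (f i) x)"
proof (rule DERIV_imp_deriv, rule DERIV_sum)
  fix i assume "i \<in> S"
  then show "((\<lambda>x. a i x * f i x) has_real_derivative
      deriv (a i) x * f i x + a i x * deriv (f i) x) (at x)"
    using assms(3) smooth_on_DERIV[OF assms(1)] smooth_on_DERIV[OF assms(2)]
    by (auto intro!: derivative_eq_intros)
qed

lemma deriv_funpow_lincomb:
  assumes "open J" "smooth_on J y" "smooth_on J z" "x \<in> J"
  shows "(deriv ^^ k) (\<lambda>x. a * y x + b * z x) x = a * (deriv ^^ k) y x + b * (deriv ^^ k) z x"
  using assms(4)
proof (induction k arbitrary: x)
  case (Suc k)
  have "deriv ((deriv ^^ k) (\<lambda>x. a * y x + b * z x)) x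
      = deriv (\<lambda>x. a * (deriv ^^ k) y x + b * (deriv ^^ k) z x) x"
    by (rule deriv_eq_on_open[OF assms(1)]) (use Suc in auto)
  also have "\<dots> = a * deriv ((deriv ^^ k) y) x + b * deriv ((deriv ^^ k) z) x"
    by (rule DERIV_imp_deriv)
       (use assms(2,3)[THEN smooth_on_deriv_funpow, THEN smooth_on_DERIV, OF Suc.prems] in
         \<open>auto intro!: derivative_eq_intros\<close>)
  finally show ?case by simp
qed simp

section \<open>Open intervals\<close>

lemma open_interval_convex: "open_interval J \<Longrightarrow> convex J"
  by (simp add: open_interval_def is_interval_convex)

lemma open_interval_Icc_subset: "open_interval J \<Longrightarrow> a \<in> J \<Longrightarrow> b \<in> J \<Longrightarrow> {a..b} \<subseteq> J"
  using mem_is_interval_1_I[of J a b] by (auto simp: open_interval_def)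

text \<open>
  Near each \<open>x\<close> the oriented integral from a base point \<open>p\<close> differs by a constant from the integral
  from the left end of a compact interval that has both \<open>p\<close> and \<open>x\<close> in its interior, and for the latter the
  fundamental theorem of calculus is available.
\<close>

lemma has_primitive_on_open_interval:
  assumes J: "open_interval J" and h: "continuous_on J h"
  shows "\<exists>F. \<forall>x\<in>J. (F has_real_derivative h x) (at x)"
proof -
  obtain p where p: "p \<in> J" using J by (auto simp: open_interval_def)
  have "open J" using J by (simp add: open_interval_def)
  \<comment> \<open>One of the two integrals is always over an interval with at most one point; together they
    form the oriented integral from \<open>p\<close>.\<close>
  define F :: "real \<Rightarrow> real" where "F = (\<lambda>z. integral {p..z} h - integral {z..p} h)"
  have "(F has_real_derivative h x) (at x)" if x: "x \<in> J" for x
  proof -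
    obtain d where d: "d > 0" "cball x d \<subseteq> J" using \<open>open J\<close> x open_contains_cball by blast
    obtain e where e: "e > 0" "cball p e \<subseteq> J" using \<open>open J\<close> p open_contains_cball by blast
    define a where "a = min (x - d) (p - e)"
    define b where "b = max (x + d) (p + e)"
    have ab: "a < x" "x < b" "a < p" "p < b" using d e by (auto simp: a_def b_def)
    have "x - d \<in> J" "x + d \<in> J" "p - e \<in> J" "p + e \<in> J"
      using d e by (auto simp: subset_iff dist_real_def)
    then have "a \<in> J" "b \<in> J" by (auto simp: a_def b_def min_def max_def)
    then have sub: "{a..b} \<subseteq> J" using open_interval_Icc_subset[OF J] by blast
    then have cont: "continuous_on {a..b} h" using h continuous_on_subset by blast
    have int: "h integrable_on {c..y}" if "a \<le> c" "y \<le> b" for c y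
      by (rule integrable_continuous_real) (use that in \<open>auto intro: continuous_on_subset[OF cont]\<close>)
    define G where "G y = integral {a..y} h" for y
    have FG: "F y = G y - G p" if "y \<in> {a<..<b}" for y
    proof (cases "p \<le> y")
      case True
      then have "G y = G p + integral {p..y} h" unfolding G_def
        using that ab int Henstock_Kurzweil_Integration.integral_combine[where
            a = a and c = p and b = y and f = h] by auto
      moreover have "integral {y..p} h = 0" using True by (cases "p = y") auto
      ultimately show ?thesis using True by (simp add: F_def)
    next
      case False
      then have "G p = G y + integral {y..p} h" unfolding G_def
        using that ab int Henstock_Kurzweil_Integration.integral_combine[where
            a = a and c = y and b = p and f = h] by auto
      then show ?thesis using False by (simp add: F_def)
    qed
    have "(G has_real_derivative h x) (at x within {a..b})"
      unfolding G_def using integral_has_real_derivative[OF cont] ab by auto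
    then have "(G has_real_derivative h x) (at x within {a<..<b})"
      by (rule DERIV_subset) auto
    then have "(G has_real_derivative h x) (at x)"
      using ab by (simp add: at_within_open[of x "{a<..<b}"])
    then have "((\<lambda>y. G y - G p) has_real_derivative h x) (at x)"
      by (auto intro!: derivative_eq_intros)
    then show ?thesis
      by (rule has_field_derivative_transform_within_open[of _ _ _ "{a<..<b}"])
         (use ab FG in auto)
  qed
  then show ?thesis by blast
qed

lemma smooth_primitive_on_open_interval:
  assumes "open_interval J" "smooth_on J h"
  obtains F where "\<And>x. x \<in> J \<Longrightarrow> (F has_real_derivative h x) (at x)" "smooth_on J F"
proof -
  have "continuous_on J h"
    by (meson DERIV_isCont assms(2) continuous_at_imp_continuous_on smooth_on_DERIV)
  then obtain F where F: "\<And>x. x \<in> J \<Longrightarrow> (F has_real_derivative h x) (at x)"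
    using has_primitive_on_open_interval[OF assms(1)] by blast
  then show ?thesis
    using that smooth_on_primitive[of J F h] assms by (auto simp: open_interval_def)
qed

lemma open_interval_infinite:
  assumes "open_interval J"
  shows "infinite J"
  using assms finite_imp_not_open by (auto simp: open_interval_def)

lemma constant_on_open_interval:
  assumes "open_interval J" "\<And>x. x \<in> J \<Longrightarrow> (f has_real_derivative 0) (at x)"
  obtains c where "\<And>x. x \<in> J \<Longrightarrow> f x = c"
  using has_field_derivative_zero_constant[OF open_interval_convex[OF assms(1)], of f] assms(2)
    has_field_derivative_at_within by blast

lemma inj_on_open_interval:
  fixes t :: "real \<Rightarrow> real"
  assumes J: "open_interval J" and t: "\<And>x. x \<in> J \<Longrightarrow> (t has_real_derivative t' x) (at x)"
    and nz: "\<And>x. x \<in> J \<Longrightarrow> t' x \<noteq> 0"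
  shows "inj_on t J"
proof (rule linorder_inj_onI')
  fix x y assume xy: "x \<in> J" "y \<in> J" "x < y"
  then have sub: "{x..y} \<subseteq> J" using open_interval_Icc_subset[OF J] by blast
  obtain z where "x < z" "z < y" "t y - t x = (y - x) * t' z"
    using MVT2[of x y t t'] xy sub t by fastforce
  then show "t x \<noteq> t y" using nz[of z] sub by (auto simp: subset_iff)
qed

section \<open>First-order operators and their iterates\<close>

lemma deriv_eq_Psi: "deriv = Psi (\<lambda>_. 1) (\<lambda>_. 0)"
  by (intro ext) (simp add: Psi_def)

lemma smooth_on_Psi:
  "open J \<Longrightarrow> smooth_on J r \<Longrightarrow> smooth_on J s \<Longrightarrow> smooth_on J y \<Longrightarrow> smooth_on J (Psi r s y)"
  unfolding Psi_def by (intro smooth_on_intros)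

lemma smooth_on_Psi_funpow:
  "open J \<Longrightarrow> smooth_on J r \<Longrightarrow> smooth_on J s \<Longrightarrow> smooth_on J y \<Longrightarrow>
    smooth_on J ((Psi r s ^^ k) y)"
  by (induction k) (auto intro: smooth_on_Psi)

lemma Psi_eq_on_open:
  "open J \<Longrightarrow> x \<in> J \<Longrightarrow> (\<And>z. z \<in> J \<Longrightarrow> f z = g z) \<Longrightarrow> Psi r s f x = Psi r s g x"
  using deriv_eq_on_open[of J x f g] by (simp add: Psi_def)

text \<open>
  The coefficients of the powers of \<open>Psi r s\<close> in the expansion of the \<open>m\<close>-th power of
  \<open>\<rho> * Psi r s + \<sigma>\<close>. The recursion is the Leibniz rule \<open>Psi r s (a * y) = r * a' * y + a * Psi r s y\<close>,
  whose second term raises the power of \<open>Psi r s\<close> by one.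
\<close>

fun expansion_coeff ::
  "(real \<Rightarrow> real) \<Rightarrow> (real \<Rightarrow> real) \<Rightarrow> (real \<Rightarrow> real) \<Rightarrow> nat \<Rightarrow> nat \<Rightarrow> real \<Rightarrow> real" where
  "expansion_coeff r \<rho> \<sigma> 0 j = (\<lambda>x. if j = 0 then 1 else 0)"
| "expansion_coeff r \<rho> \<sigma> (Suc m) j = (\<lambda>x.
     \<rho> x * (r x * deriv (expansion_coeff r \<rho> \<sigma> m j) x
             + (if j = 0 then 0 else expansion_coeff r \<rho> \<sigma> m (j - 1) x))
       + \<sigma> x * expansion_coeff r \<rho> \<sigma> m j x)"

lemma smooth_on_expansion_coeff:
  assumes "open J" "smooth_on J r" "smooth_on J \<rho>" "smooth_on J \<sigma>"
  shows "smooth_on J (expansion_coeff r \<rho> \<sigma> m j)"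
proof (induction m arbitrary: j)
  case (Suc m)
  show ?case
    by (cases j) (use assms Suc in \<open>auto intro!: smooth_on_intros\<close>)
qed (simp add: smooth_on_const)

lemma expansion_coeff_eq_0: "m < j \<Longrightarrow> expansion_coeff r \<rho> \<sigma> m j = (\<lambda>x. 0)"
  by (induction m arbitrary: j) auto

lemma expansion_coeff_diag: "expansion_coeff r \<rho> \<sigma> m m = (\<lambda>x. \<rho> x ^ m)"
  by (induction m) (auto simp: expansion_coeff_eq_0)

text \<open>
  This is used in both directions: to write an iterate of \<open>Psi r s\<close> as an ordinary differential
  operator, and to write an ordinary differential operator in powers of \<open>Psi r s\<close>.
\<close>

lemma Psi_funpow_expansion:
  assumes J: "open J" and sm: "smooth_on J r" "smooth_on J s" "smooth_on J \<rho>" "smooth_on J \<sigma>"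
    and R: "\<And>x. x \<in> J \<Longrightarrow> R x = \<rho> x * r x" and S: "\<And>x. x \<in> J \<Longrightarrow> S x = \<rho> x * s x + \<sigma> x"
    and y: "smooth_on J y" and "x \<in> J"
  shows "(Psi R S ^^ m) y x = (\<Sum>j\<le>m. expansion_coeff r \<rho> \<sigma> m j x * (Psi r s ^^ j) y x)"
  using \<open>x \<in> J\<close>
proof (induction m arbitrary: x)
  case (Suc m)
  let ?K = "expansion_coeff r \<rho> \<sigma>"
  let ?P = "\<lambda>j. (Psi r s ^^ j) y"
  have smK: "smooth_on J (?K m j)" for j
    using smooth_on_expansion_coeff[OF J] sm by blast
  have smP: "smooth_on J (?P j)" for j
    using smooth_on_Psi_funpow[OF J] sm y by blast
  have step: "\<rho> x * r x * (deriv (?K m j) x * ?P j x + ?K m j x * deriv (?P j) x)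
        + (\<rho> x * s x + \<sigma> x) * (?K m j x * ?P j x)
      = (\<rho> x * r x * deriv (?K m j) x + \<sigma> x * ?K m j x) * ?P j x
        + \<rho> x * ?K m j x * ?P (Suc j) x" for j
    by (simp add: Psi_def algebra_simps)
  have "(Psi R S ^^ Suc m) y x = Psi R S (\<lambda>z. \<Sum>j\<le>m. ?K m j z * ?P j z) x"
    unfolding funpow.simps comp_apply by (rule Psi_eq_on_open[OF J Suc.prems Suc.IH])
  also have "\<dots> = \<rho> x * r x * (\<Sum>j\<le>m. deriv (?K m j) x * ?P j x + ?K m j x * deriv (?P j) x)
        + (\<rho> x * s x + \<sigma> x) * (\<Sum>j\<le>m. ?K m j x * ?P j x)"
  proof -
    have "deriv (\<lambda>z. \<Sum>j\<le>m. ?K m j z * ?P j z) x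
        = (\<Sum>j\<le>m. deriv (?K m j) x * ?P j x + ?K m j x * deriv (?P j) x)"
      by (rule deriv_sum_mult[OF smK smP Suc.prems])
    then show ?thesis
      using R S Suc.prems by (simp add: Psi_def[of R S])
  qed
  also have "\<dots> = (\<Sum>j\<le>m. (\<rho> x * r x * deriv (?K m j) x + \<sigma> x * ?K m j x) * ?P j x)
        + (\<Sum>j\<le>m. \<rho> x * ?K m j x * ?P (Suc j) x)"
    unfolding sum_distrib_left sum.distrib[symmetric] step ..
  also have "(\<Sum>j\<le>m. (\<rho> x * r x * deriv (?K m j) x + \<sigma> x * ?K m j x) * ?P j x)
      = (\<Sum>j\<le>Suc m. (\<rho> x * r x * deriv (?K m j) x + \<sigma> x * ?K m j x) * ?P j x)"
    by (simp add: expansion_coeff_eq_0)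
  also have "(\<Sum>j\<le>m. \<rho> x * ?K m j x * ?P (Suc j) x)
      = (\<Sum>j\<le>Suc m. \<rho> x * (if j = 0 then 0 else ?K m (j - 1) x) * ?P j x)"
    by (simp only: sum.atMost_Suc_shift) simp
  also have "(\<Sum>j\<le>Suc m. (\<rho> x * r x * deriv (?K m j) x + \<sigma> x * ?K m j x) * ?P j x)
        + (\<Sum>j\<le>Suc m. \<rho> x * (if j = 0 then 0 else ?K m (j - 1) x) * ?P j x)
      = (\<Sum>j\<le>Suc m. ?K (Suc m) j x * ?P j x)"
    unfolding sum.distrib[symmetric] expansion_coeff.simps(2)
    by (rule sum.cong[OF refl]) (simp add: algebra_simps)
  finally show ?case .
qed simp

text \<open>
  The factor \<open>k (k - 1) \<dots> (k - j + 1)\<close> that \<open>j\<close> differentiations of a \<open>k\<close>-th power produce. Taken over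
  the reals, it vanishes by itself for \<open>j > k\<close>, where the truncated exponent \<open>k - j\<close> is meaningless.
\<close>

lemma ffact_nonzero: "j \<le> k \<Longrightarrow> (\<Prod>i<j. real k - real i) \<noteq> 0"
  by (auto simp: prod_zero_iff)

lemma ffact_zero: "k < j \<Longrightarrow> (\<Prod>i<j. real k - real i) = 0"
  by (rule prod_zero) auto

text \<open>
  The hypotheses say that \<open>Psi r s \<phi> = 0\<close> and that \<open>r d/dx\<close> is differentiation with respect to \<open>t\<close>.
  Hence \<open>Psi r s\<close> acts on \<open>\<phi> * g\<close> by differentiating \<open>g\<close> with respect to \<open>t\<close>, and on powers of
  \<open>t - \<tau>\<close> it acts as on monomials.
\<close>

lemma Psi_funpow_gauged_power:
  assumes J: "open J"
    and \<phi>: "\<And>x. x \<in> J \<Longrightarrow> (\<phi> has_real_derivative \<phi>' x) (at x)"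
      "\<And>x. x \<in> J \<Longrightarrow> r x * \<phi>' x + s x * \<phi> x = 0"
    and t: "\<And>x. x \<in> J \<Longrightarrow> (t has_real_derivative t' x) (at x)" "\<And>x. x \<in> J \<Longrightarrow> r x * t' x = 1"
    and "x \<in> J"
  shows "(Psi r s ^^ j) (\<lambda>z. \<phi> z * (t z - \<tau>) ^ k) x
    = \<phi> x * (\<Prod>i<j. real k - real i) * (t x - \<tau>) ^ (k - j)"
  using \<open>x \<in> J\<close>
proof (induction j arbitrary: x)
  case (Suc j)
  let ?c = "\<Prod>i<j. real k - real i"
  have c: "?c * real (k - j) = ?c * (real k - real j)"
    using ffact_zero[of k j] by (cases "j \<le> k") auto
  have "((\<lambda>z. \<phi> z * ?c * (t z - \<tau>) ^ (k - j)) has_real_derivative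
      \<phi>' x * ?c * (t x - \<tau>) ^ (k - j)
        + \<phi> x * (?c * real (k - j)) * (t x - \<tau>) ^ (k - Suc j) * t' x) (at x)"
    using \<phi>(1)[OF Suc.prems] t(1)[OF Suc.prems]
    by (auto intro!: derivative_eq_intros simp: algebra_simps)
  then have "Psi r s (\<lambda>z. \<phi> z * ?c * (t z - \<tau>) ^ (k - j)) x
      = (r x * \<phi>' x + s x * \<phi> x) * (?c * (t x - \<tau>) ^ (k - j))
        + (r x * t' x) * (\<phi> x * (?c * (real k - real j)) * (t x - \<tau>) ^ (k - Suc j))"
    unfolding Psi_def c by (simp add: DERIV_imp_deriv algebra_simps)
  then have "Psi r s (\<lambda>z. \<phi> z * ?c * (t z - \<tau>) ^ (k - j)) x
      = \<phi> x * (?c * (real k - real j)) * (t x - \<tau>) ^ (k - Suc j)"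
    using \<phi>(2) t(2) Suc.prems by simp
  moreover have "(Psi r s ^^ Suc j) (\<lambda>z. \<phi> z * (t z - \<tau>) ^ k) x
      = Psi r s (\<lambda>z. \<phi> z * ?c * (t z - \<tau>) ^ (k - j)) x"
    unfolding funpow.simps comp_apply by (rule Psi_eq_on_open[OF J Suc.prems Suc.IH])
  ultimately show ?case by (simp add: mult.assoc)
qed simp

text \<open>
  Such test functions isolate one coefficient of a linear differential operator at \<open>x\<close>. They are normalized
  powers of \<open>z - x\<close>, whose derivatives are the trivially gauged case of the preceding lemma.
\<close>

lemma exists_function_with_jet:
  assumes "open J"
  shows "\<exists>y. smooth_on J y \<and> (\<forall>j. (deriv ^^ j) y x = (if j = i then 1 else 0 :: real))"
proof (intro exI conjI allI)
  let ?c = "\<Prod>l<i. real i - real l"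
  let ?y = "\<lambda>z. (1 / ?c) * (z - x) ^ i"
  show "smooth_on J ?y"
    using assms by (intro smooth_on_intros smooth_on_ident)
  fix j
  have "(deriv ^^ j) ?y x = (1 / ?c) * (\<Prod>l<j. real i - real l) * (x - x) ^ (i - j)"
    unfolding deriv_eq_Psi
    by (rule Psi_funpow_gauged_power[of UNIV "\<lambda>_. 1 / ?c" "\<lambda>_. 0" _ _ "\<lambda>z. z" "\<lambda>_. 1"]) auto
  then show "(deriv ^^ j) ?y x = (if j = i then 1 else 0)"
    using ffact_nonzero[of i i] ffact_zero[of i j] by (cases i j rule: linorder_cases) auto
qed

section \<open>The three leading coefficients of an iterated operator\<close>

lemma expansion_coeff_subdiag:
  assumes sm: "smooth_on J r" and "x \<in> J"
  shows "expansion_coeff (\<lambda>_. 1) r s (Suc m) m x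
    = r x ^ m * ((real m + 1) * s x + real m * (real m + 1) / 2 * deriv r x)"
proof (induction m)
  case (Suc m)
  have "deriv (\<lambda>x. r x ^ Suc m) x = (real m + 1) * r x ^ m * deriv r x"
    using DERIV_power_Suc[OF smooth_on_DERIV[OF sm \<open>x \<in> J\<close>], of m]
    by (simp add: DERIV_imp_deriv algebra_simps)
  then show ?case
    using Suc by (simp add: expansion_coeff_diag[of _ _ _ "Suc m"] del: expansion_coeff.simps(2)
      add: expansion_coeff.simps(2)[of _ _ _ "Suc m"]) (simp add: field_simps)
qed simp

text \<open>
  Since \<open>s\<close> is known to be a multiple of \<open>r'\<close> by the time this coefficient is compared, it is computed
  only in that case. The two brackets are found by summing the recursion over \<open>m\<close>.
\<close>

lemma expansion_coeff_subsubdiag: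
  assumes J: "open J" and sm: "smooth_on J r" and s: "\<And>x. x \<in> J \<Longrightarrow> s x = - \<kappa> * deriv r x"
    and x: "x \<in> J"
  shows "expansion_coeff (\<lambda>_. 1) r s (Suc (Suc m)) m x
    = r x ^ m * (real m + 2) * (real m + 1) *
        ((real m * (real m - 1) / 8 + real m / 6 - \<kappa> * real m / 2 + \<kappa>\<^sup>2 / 2) * (deriv r x)\<^sup>2
         + (real m / 6 - \<kappa> / 2) * r x * deriv (deriv r) x)"
proof (induction m)
  case 0
  have "deriv (expansion_coeff (\<lambda>_. 1) r s (Suc 0) 0) x = deriv (\<lambda>x. - \<kappa> * deriv r x) x"
    by (rule deriv_eq_on_open[OF J x]) (simp add: s)
  also have "\<dots> = - \<kappa> * deriv (deriv r) x"
    by (rule DERIV_imp_deriv)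
       (use smooth_on_DERIV[OF smooth_on_deriv[OF sm] x] in \<open>auto intro!: derivative_eq_intros\<close>)
  finally show ?case
    using s[OF x] by (simp add: expansion_coeff.simps(2)[of _ _ _ "Suc 0"]
      del: expansion_coeff.simps(2)) (simp add: expansion_coeff.simps power2_eq_square)
next
  case (Suc m)
  let ?\<mu> = "(real m + 2) * ((real m + 1) / 2 - \<kappa>)"
  have sub: "expansion_coeff (\<lambda>_. 1) r s (Suc (Suc m)) (Suc m) z
      = ?\<mu> * (r z ^ Suc m * deriv r z)" if "z \<in> J" for z
    unfolding expansion_coeff_subdiag[OF sm that] using s[OF that] by (simp add: field_simps)
  have "deriv (expansion_coeff (\<lambda>_. 1) r s (Suc (Suc m)) (Suc m)) x
      = deriv (\<lambda>z. ?\<mu> * (r z ^ Suc m * deriv r z)) x"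
    by (rule deriv_eq_on_open[OF J x]) (rule sub)
  also have "\<dots> = ?\<mu> * ((real m + 1) * r x ^ m * (deriv r x)\<^sup>2 + r x ^ Suc m * deriv (deriv r) x)"
  proof (rule DERIV_imp_deriv, rule DERIV_cmult)
    show "((\<lambda>z. r z ^ Suc m * deriv r z) has_real_derivative
        (real m + 1) * r x ^ m * (deriv r x)\<^sup>2 + r x ^ Suc m * deriv (deriv r) x) (at x)"
      using DERIV_mult[OF DERIV_power_Suc[OF smooth_on_DERIV[OF sm x], of m]
          smooth_on_DERIV[OF smooth_on_deriv[OF sm] x]]
      by (simp add: power2_eq_square algebra_simps)
  qed
  finally have d: "deriv (expansion_coeff (\<lambda>_. 1) r s (Suc (Suc m)) (Suc m)) x
      = ?\<mu> * ((real m + 1) * r x ^ m * (deriv r x)\<^sup>2 + r x ^ Suc m * deriv (deriv r) x)" .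
  have "expansion_coeff (\<lambda>_. 1) r s (Suc (Suc (Suc m))) (Suc m) x
      = r x * (deriv (expansion_coeff (\<lambda>_. 1) r s (Suc (Suc m)) (Suc m)) x
               + expansion_coeff (\<lambda>_. 1) r s (Suc (Suc m)) m x)
        + s x * expansion_coeff (\<lambda>_. 1) r s (Suc (Suc m)) (Suc m) x"
    by (subst expansion_coeff.simps(2)) simp
  also have "\<dots> = r x * (?\<mu> * ((real m + 1) * r x ^ m * (deriv r x)\<^sup>2 + r x ^ Suc m * deriv (deriv r) x)
        + r x ^ m * (real m + 2) * (real m + 1) *
        ((real m * (real m - 1) / 8 + real m / 6 - \<kappa> * real m / 2 + \<kappa>\<^sup>2 / 2) * (deriv r x)\<^sup>2
         + (real m / 6 - \<kappa> / 2) * r x * deriv (deriv r) x))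
        + (- \<kappa> * deriv r x) * (?\<mu> * (r x ^ Suc m * deriv r x))"
    unfolding d sub[OF x] Suc.IH s[OF x] ..
  also have "\<dots> = r x ^ Suc m * (real (Suc m) + 2) * (real (Suc m) + 1) *
        ((real (Suc m) * (real (Suc m) - 1) / 8 + real (Suc m) / 6 - \<kappa> * real (Suc m) / 2
            + \<kappa>\<^sup>2 / 2) * (deriv r x)\<^sup>2
         + (real (Suc m) / 6 - \<kappa> / 2) * r x * deriv (deriv r) x)"
  proof -
    \<comment> \<open>With the derivatives and the power of \<open>r\<close> treated as unknowns, the claim is a polynomial identity.\<close>
    have alg: "\<rho> * (((a + 2) * ((a + 1) / 2 - \<kappa>)) * ((a + 1) * p * d\<^sup>2 + \<rho> * p * e)
        + p * (a + 2) * (a + 1) *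
        ((a * (a - 1) / 8 + a / 6 - \<kappa> * a / 2 + \<kappa>\<^sup>2 / 2) * d\<^sup>2 + (a / 6 - \<kappa> / 2) * \<rho> * e))
        + (- \<kappa> * d) * (((a + 2) * ((a + 1) / 2 - \<kappa>)) * (\<rho> * p * d))
      = \<rho> * p * (1 + a + 2) * (1 + a + 1) *
        (((1 + a) * (1 + a - 1) / 8 + (1 + a) / 6 - \<kappa> * (1 + a) / 2 + \<kappa>\<^sup>2 / 2) * d\<^sup>2
         + ((1 + a) / 6 - \<kappa> / 2) * \<rho> * e)" for \<rho> a p d e \<kappa> :: real
      by (simp add: field_simps power2_eq_square)
    show ?thesis
      unfolding of_nat_Suc power_Suc by (rule alg)
  qed
  finally show ?case .
qed

lemma choose_three: "real ((n + 1) choose 3) = (real n + 1) * real n * (real n - 1) / 6"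
proof (induction n)
  case (Suc n)
  have "real ((Suc n + 1) choose 3) = real ((n + 1) choose 3) + real ((n + 1) choose 2)"
    by (simp add: numeral_3_eq_3 numeral_2_eq_2)
  moreover have "2 * ((n + 1) choose 2) = (n + 1) * n"
    by (induction n) (auto simp: numeral_2_eq_2)
  then have "2 * real ((n + 1) choose 2) = (real n + 1) * real n"
    by (metis of_nat_1 of_nat_add of_nat_mult of_nat_numeral)
  ultimately show ?case using Suc by (simp add: field_simps)
qed (simp add: numeral_3_eq_3)

section \<open>Linear combinations of solutions\<close>

lemma solution_on_cong:
  assumes J: "open J" and y: "solution_on J (normal_form n A) y" and eq: "\<And>x. x \<in> J \<Longrightarrow> y x = z x"
  shows "solution_on J (normal_form n A) z"
proof -
  have "(deriv ^^ k) y x = (deriv ^^ k) z x" if "x \<in> J" for k x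
    by (rule deriv_funpow_eq_on_open[OF J that eq])
  then show ?thesis
    using y smooth_on_cong[OF J _ eq] unfolding solution_on_def normal_form_def by simp
qed

lemma solution_on_lincomb:
  assumes J: "open J"
    and y: "solution_on J (normal_form n A) y" and z: "solution_on J (normal_form n A) z"
  shows "solution_on J (normal_form n A) (\<lambda>x. a * y x + b * z x)"
proof -
  have sm: "smooth_on J y" "smooth_on J z" using y z by (auto simp: solution_on_def)
  have "normal_form n A (\<lambda>x. a * y x + b * z x) x
      = a * normal_form n A y x + b * normal_form n A z x" if "x \<in> J" for x
    unfolding normal_form_def deriv_funpow_lincomb[OF J sm that]
    by (simp add: algebra_simps sum.distrib sum_distrib_left)
  then show ?thesis
    using y z J unfolding solution_on_def by (auto intro!: smooth_on_intros)
qed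

text \<open>
  The products \<open>u\<^sup>i v\<^sup>j\<close> with \<open>i + j = N\<close> span the binary forms of degree \<open>N\<close> in \<open>u\<close> and \<open>v\<close>, and
  this span does not change under linear substitutions. It therefore does no harm to replace \<open>u\<close>
  and \<open>v\<close> by linear combinations. The proof trades one linear factor after the other for
  \<open>u\<close> or \<open>v\<close>, which avoids binomial expansions.
\<close>

lemma solution_on_binary_forms:
  assumes J: "open J"
    and sol: "\<And>i j. i + j = N \<Longrightarrow> solution_on J (normal_form n A) (\<lambda>x. u x ^ i * v x ^ j)"
    and "k + l = N"
  shows "solution_on J (normal_form n A)
    (\<lambda>x. (\<alpha> * u x + \<beta> * v x) ^ k * (\<gamma> * u x + \<delta> * v x) ^ l)"
proof -
  let ?f = "\<lambda>x. \<alpha> * u x + \<beta> * v x" and ?g = "\<lambda>x. \<gamma> * u x + \<delta> * v x"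
  have one: "solution_on J (normal_form n A) (\<lambda>x. u x ^ i * v x ^ j * ?f x ^ k)"
    if "i + j + k = N" for i j k
    using that
  proof (induction k arbitrary: i j)
    case (Suc k)
    show ?case
      by (rule solution_on_cong[OF J solution_on_lincomb[OF J
            Suc.IH[of "Suc i" j] Suc.IH[of i "Suc j"], of \<alpha> \<beta>]])
         (use Suc.prems in \<open>simp_all add: algebra_simps\<close>)
  qed (use sol in simp)
  have "solution_on J (normal_form n A) (\<lambda>x. u x ^ i * v x ^ j * ?f x ^ k * ?g x ^ l)"
    if "i + j + k + l = N" for i j k l
    using that
  proof (induction l arbitrary: i j)
    case (Suc l)
    show ?case
      by (rule solution_on_cong[OF J solution_on_lincomb[OF J
            Suc.IH[of "Suc i" j] Suc.IH[of i "Suc j"], of \<gamma> \<delta>]])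
         (use Suc.prems in \<open>simp_all add: algebra_simps\<close>)
  qed (use one in simp)
  from this[of 0 0 k l] show ?thesis using assms(3) by simp
qed

text \<open>
  A linear relation would be a polynomial with a zero at every value of \<open>t\<close>.
\<close>

lemma lin_indep_on_gauged_powers:
  assumes J: "infinite J" and inj: "inj_on t J" and \<phi>: "\<And>x. x \<in> J \<Longrightarrow> \<phi> x \<noteq> 0"
    and f: "\<And>k x. k < m \<Longrightarrow> x \<in> J \<Longrightarrow> f k x = \<phi> x * t x ^ k"
  shows "lin_indep_on J m f"
  unfolding lin_indep_on_def
proof (intro allI impI)
  fix c :: "nat \<Rightarrow> real" and k
  assume z: "\<forall>x\<in>J. (\<Sum>k<m. c k * f k x) = 0" and k: "k < m"
  obtain M where M: "m = Suc M" using k by (cases m) auto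
  have "(\<Sum>k\<le>M. c k * t x ^ k) = 0" if x: "x \<in> J" for x
  proof -
    have "\<phi> x * (\<Sum>k<m. c k * t x ^ k) = (\<Sum>k<m. c k * f k x)"
      unfolding sum_distrib_left by (rule sum.cong) (use f x in auto)
    then show ?thesis using z x \<phi> M lessThan_Suc_atMost by auto
  qed
  then have "t ` J \<subseteq> {z. (\<Sum>k\<le>M. c k * z ^ k) = 0}" by auto
  moreover have "infinite (t ` J)" using J inj finite_imageD by blast
  ultimately have "infinite {z. (\<Sum>k\<le>M. c k * z ^ k) = 0}" using finite_subset by blast
  then show "c k = 0" using polyfun_rootbound_finite[where c = c and n = M] k M less_Suc_eq_le by blast
qed

section \<open>A solution without zeros\<close>

text \<open>
  Let \<open>M\<close> be the maximum of \<open>\<bar>f\<bar>\<close> between \<open>p\<close> and \<open>x\<close>. Two applications of the mean value theorem bound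
  \<open>\<bar>f'\<bar>\<close> by \<open>K M d\<close> and then \<open>\<bar>f - f p\<bar>\<close> by \<open>K M d\<^sup>2 \<le> M/4\<close>. In particular \<open>M \<le> \<bar>f p\<bar> + M/4\<close>, which turns
  \<open>M/4\<close> into \<open>\<bar>f p\<bar>/3\<close>. If \<open>f p \<noteq> 0\<close> then \<open>f\<close> has no zeros, and if \<open>f p = 0\<close> then \<open>f\<close> vanishes
  identically; both consequences are needed below.
\<close>

lemma solution_close_to_initial_value:
  fixes f f' q :: "real \<Rightarrow> real"
  assumes J: "open_interval J" and p: "p \<in> J" and f'p: "f' p = 0"
    and f: "\<And>x. x \<in> J \<Longrightarrow> (f has_real_derivative f' x) (at x)"
    and f': "\<And>x. x \<in> J \<Longrightarrow> (f' has_real_derivative - q x * f x) (at x)"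
    and q: "\<And>x. x \<in> J \<Longrightarrow> \<bar>q x\<bar> \<le> K" and d: "\<And>x. x \<in> J \<Longrightarrow> \<bar>x - p\<bar> \<le> d"
    and Kd: "K * d\<^sup>2 \<le> 1 / 4"
    and x: "x \<in> J"
  shows "\<bar>f x - f p\<bar> \<le> \<bar>f p\<bar> / 3"
proof -
  let ?S = "closed_segment p x"
  have sub: "?S \<subseteq> J"
    using closed_segment_subset[OF p x open_interval_convex[OF J]] .
  have "continuous_on ?S (\<lambda>z. \<bar>f z\<bar>)"
    using f sub by (intro continuous_on_rabs continuous_at_imp_continuous_on)
      (auto dest!: subsetD intro: DERIV_isCont)
  then obtain m where m: "m \<in> ?S" "\<And>z. z \<in> ?S \<Longrightarrow> \<bar>f z\<bar> \<le> \<bar>f m\<bar>"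
    using continuous_attains_sup[of ?S "\<lambda>z. \<bar>f z\<bar>"] by auto
  have K0: "0 \<le> K" using q[OF p] by auto
  have d0: "0 \<le> d" using d[OF p] by auto
  have f'_bound: "\<bar>f' z\<bar> \<le> K * \<bar>f m\<bar> * d" if z: "z \<in> ?S" for z
  proof -
    have "norm (f' z - f' p) \<le> (K * \<bar>f m\<bar>) * norm (z - p)"
    proof (rule field_differentiable_bound[where S = ?S and f' = "\<lambda>z. - q z * f z"])
      show "(f' has_field_derivative - q w * f w) (at w within ?S)" if "w \<in> ?S" for w
        using f' that sub has_field_derivative_at_within by blast
      show "norm (- q w * f w) \<le> K * \<bar>f m\<bar>" if "w \<in> ?S" for w
        using q[of w] m(2)[of w] that sub by (auto simp: abs_mult intro!: mult_mono)
    qed (use z in auto)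
    also have "\<dots> \<le> (K * \<bar>f m\<bar>) * d"
      using d[of z] z sub K0 by (intro mult_left_mono) auto
    finally show ?thesis using f'p by simp
  qed
  have f_bound: "\<bar>f z - f p\<bar> \<le> \<bar>f m\<bar> / 4" if z: "z \<in> ?S" for z
  proof -
    have "norm (f z - f p) \<le> (K * \<bar>f m\<bar> * d) * norm (z - p)"
    proof (rule field_differentiable_bound[where S = ?S and f' = f'])
      show "(f has_field_derivative f' w) (at w within ?S)" if "w \<in> ?S" for w
        using f that sub has_field_derivative_at_within by blast
    qed (use z f'_bound in auto)
    also have "\<dots> \<le> (K * \<bar>f m\<bar> * d) * d"
      using d[of z] z sub K0 d0 by (intro mult_left_mono) auto
    also have "\<dots> = (K * d\<^sup>2) * \<bar>f m\<bar>" by (simp add: power2_eq_square)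
    also have "\<dots> \<le> 1 / 4 * \<bar>f m\<bar>" using Kd by (intro mult_right_mono) auto
    finally show ?thesis by simp
  qed
  have "\<bar>f m\<bar> \<le> \<bar>f p\<bar> + \<bar>f m - f p\<bar>" by arith
  with f_bound[OF m(1)] f_bound[of x] show ?thesis by auto
qed

section \<open>Iterative equations have power solutions\<close>

text \<open>
  Order \<open>n\<close> gives \<open>c = r\<^sup>n\<close>, order \<open>n - 1\<close> gives \<open>s\<close> because the normal form has no term of that
  order, and order \<open>n - 2\<close> gives \<open>A 2\<close>. Inserting \<open>s\<close> produces the common factor
  \<open>(n + 1) n (n - 1) / 6\<close>, which is the binomial coefficient in \<open>source_coeff\<close>.
\<close>

lemma iterative_coefficients:
  assumes n: "2 \<le> n" and J: "open J" and r: "smooth_on J r" and s: "smooth_on J s"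
    and eq: "\<And>y x. smooth_on J y \<Longrightarrow> x \<in> J \<Longrightarrow> (Psi r s ^^ n) y x = c x * normal_form n A y x"
    and r0: "\<And>x. x \<in> J \<Longrightarrow> r x \<noteq> 0" and x: "x \<in> J"
  shows "s x = - ((real n - 1) / 2) * deriv r x"
    and "source_coeff n A x = (deriv r x)\<^sup>2 / (4 * (r x)\<^sup>2) - deriv (deriv r) x / (2 * r x)"
proof -
  let ?K = "expansion_coeff (\<lambda>_. 1) r s"
  obtain m where m: "n = Suc (Suc m)" using n by (metis add_2_eq_Suc le_Suc_ex)
  have coeff: "?K n i z = c z * ((if i = n then 1 else 0)
      + (\<Sum>j=2..n. A j z * (if n - j = i then 1 else 0)))" if z: "z \<in> J" and i: "i \<le> n" for z i
  proof -
    obtain y where y: "smooth_on J y" "\<And>j. (deriv ^^ j) y z = (if j = i then 1 else 0)"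
      using exists_function_with_jet[OF J, of z i] by auto
    have "(Psi r s ^^ n) y z = (\<Sum>j\<le>n. ?K n j z * (Psi (\<lambda>_. 1) (\<lambda>_. 0) ^^ j) y z)"
      by (rule Psi_funpow_expansion[OF J smooth_on_const smooth_on_const r s _ _ y(1) z]) auto
    also have "\<dots> = (\<Sum>j\<le>n. if j = i then ?K n j z else 0)"
      unfolding deriv_eq_Psi[symmetric] y(2) by (rule sum.cong) auto
    also have "\<dots> = ?K n i z" using i by simp
    finally show ?thesis
      using eq[OF y(1) z] unfolding normal_form_def y(2) by auto
  qed
  have lead: "c z = r z ^ n" if "z \<in> J" for z
  proof -
    have "(\<Sum>j=2..n. A j z * (if n - j = n then 1 else 0)) = 0"
      using n by (intro sum.neutral) auto
    then show ?thesis using coeff[OF that, of n] by (simp add: expansion_coeff_diag)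
  qed
  have s_eq: "s z = - ((real n - 1) / 2) * deriv r z" if z: "z \<in> J" for z
  proof -
    have "(\<Sum>j=2..n. A j z * (if n - j = n - 1 then 1 else 0)) = 0"
      using n by (intro sum.neutral) auto
    then have "?K n (n - 1) z = 0" using coeff[OF z, of "n - 1"] n by simp
    then have "r z ^ Suc m * ((real m + 2) * (s z + (real m + 1) / 2 * deriv r z)) = 0"
      using expansion_coeff_subdiag[OF r z, of s "Suc m"]
      by (simp add: m algebra_simps add_divide_distrib del: expansion_coeff.simps)
    then have "s z + (real m + 1) / 2 * deriv r z = 0"
      using r0[OF z] by (simp add: add_eq_0_iff)
    then show ?thesis by (simp add: m field_simps)
  qed
  then show "s x = - ((real n - 1) / 2) * deriv r x" using x .
  have "(\<Sum>j=2..n. A j x * (if n - j = n - 2 then 1 else 0)) = (\<Sum>j=2..n. if j = 2 then A j x else 0)"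
    using n by (intro sum.cong) auto
  also have "\<dots> = A 2 x" using n by simp
  finally have "?K n (n - 2) x = r x ^ n * A 2 x"
    using coeff[OF x, of "n - 2"] lead[OF x] n by simp
  then have "?K (Suc (Suc m)) m x = r x ^ Suc (Suc m) * A 2 x"
    unfolding m by (simp only: diff_Suc_Suc numeral_2_eq_2 diff_zero)
  then have "r x ^ m * ((r x)\<^sup>2 * A 2 x) = r x ^ m * ((real m + 2) * (real m + 1) * ((real m + 3) / 24 *
      (deriv r x)\<^sup>2 - (real m + 3) / 12 * r x * deriv (deriv r) x))"
    using expansion_coeff_subsubdiag[OF J r s_eq x, of m]
    unfolding m of_nat_Suc by (simp add: field_simps power2_eq_square del: expansion_coeff.simps)
  then have "(r x)\<^sup>2 * A 2 x = (real m + 2) * (real m + 1) * ((real m + 3) / 24 *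
      (deriv r x)\<^sup>2 - (real m + 3) / 12 * r x * deriv (deriv r) x)"
    using r0[OF x] by simp
  then have A2: "A 2 x = ((real m + 2) * (real m + 1) * (real m + 3) / 6)
      * ((deriv r x)\<^sup>2 / (4 * (r x)\<^sup>2) - deriv (deriv r) x / (2 * r x))"
    using r0[OF x] by (simp add: field_simps power2_eq_square)
  have choose: "real ((n + 1) choose 3) = (real m + 2) * (real m + 1) * (real m + 3) / 6"
    unfolding choose_three by (simp add: m algebra_simps)
  show "source_coeff n A x = (deriv r x)\<^sup>2 / (4 * (r x)\<^sup>2) - deriv (deriv r) x / (2 * r x)"
    unfolding source_coeff_def A2 choose by (rule nonzero_mult_div_cancel_left) auto
qed

text \<open>
  With \<open>a = r'/(2r)\<close> the formula for the source coefficient becomes the Riccati equation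
  \<open>a' = -q - a\<^sup>2\<close>, whose substitution \<open>u' = a u\<close> turns it into \<open>u'' + q u = 0\<close>. The partner
  \<open>v = u T\<close> with \<open>T' = 1/r\<close> solves the same equation since \<open>u\<^sup>2/r\<close> is constant.
\<close>

lemma power_solutions_if_iterative:
  assumes n: "2 \<le> n" and J: "open_interval J" and it: "iterative_on J n (normal_form n A)"
  shows "has_power_solutions_on J n A"
proof -
  have opn: "open J" using J by (simp add: open_interval_def)
  obtain r s where r: "smooth_on J r" and s: "smooth_on J s" and r0: "\<And>x. x \<in> J \<Longrightarrow> r x \<noteq> 0"
    and same: "same_equation_on J (Psi r s ^^ n) (normal_form n A)"
    using it unfolding iterative_on_def by auto
  obtain c where c0: "\<And>x. x \<in> J \<Longrightarrow> c x \<noteq> 0"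
    and eq: "\<And>y x. smooth_on J y \<Longrightarrow> x \<in> J \<Longrightarrow> (Psi r s ^^ n) y x = c x * normal_form n A y x"
    using same unfolding same_equation_on_def by auto
  have s_eq: "s x = - ((real n - 1) / 2) * deriv r x"
    and q_eq: "source_coeff n A x = (deriv r x)\<^sup>2 / (4 * (r x)\<^sup>2) - deriv (deriv r) x / (2 * r x)"
    if "x \<in> J" for x
    by (rule iterative_coefficients[OF n opn r s eq r0 that]; assumption)+
  define a where "a = (\<lambda>x. deriv r x / (2 * r x))"
  have a: "smooth_on J a"
    unfolding a_def using opn r r0 by (intro smooth_on_divide smooth_on_intros) auto
  have a': "(a has_real_derivative - source_coeff n A x - (a x)\<^sup>2) (at x)" if x: "x \<in> J" for x
    unfolding a_def q_eq[OF x] using r0[OF x]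
      smooth_on_DERIV[OF r x] smooth_on_DERIV[OF smooth_on_deriv[OF r] x]
    by (auto intro!: derivative_eq_intros simp: field_simps power2_eq_square)
  obtain F where F: "\<And>x. x \<in> J \<Longrightarrow> (F has_real_derivative a x) (at x)"
    using smooth_primitive_on_open_interval[OF J a] by blast
  have inv: "smooth_on J (\<lambda>x. 1 / r x)"
    using opn r r0 by (intro smooth_on_divide smooth_on_intros) auto
  obtain T where T: "\<And>x. x \<in> J \<Longrightarrow> (T has_real_derivative 1 / r x) (at x)" "smooth_on J T"
    using smooth_primitive_on_open_interval[OF J inv] by blast
  define u where "u = (\<lambda>x. exp (F x))"
  define v where "v = (\<lambda>x. u x * T x)"
  have u0: "u x \<noteq> 0" for x by (simp add: u_def)
  have u': "(u has_real_derivative a x * u x) (at x)" if "x \<in> J" for x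
    unfolding u_def using F[OF that] by (auto intro!: derivative_eq_intros)
  have v': "(v has_real_derivative a x * v x + u x / r x) (at x)" if "x \<in> J" for x
    unfolding v_def using u'[OF that] T(1)[OF that]
    by (auto intro!: derivative_eq_intros simp: algebra_simps)
  have u: "smooth_on J u" by (rule smooth_on_linear_ode[OF opn u' a])
  have v: "smooth_on J v" unfolding v_def using opn u T(2) by (rule smooth_on_mult)
  have "(deriv ^^ 2) u x = - source_coeff n A x * u x" if x: "x \<in> J" for x
  proof -
    have "(deriv ^^ 2) u x = deriv (\<lambda>x. a x * u x) x"
      unfolding numeral_2_eq_2 funpow.simps comp_apply id_apply
      by (rule deriv_eq_on_open[OF opn x]) (rule DERIV_imp_deriv[OF u'])
    also have "\<dots> = - source_coeff n A x * u x"
      by (rule DERIV_imp_deriv) (use a'[OF x] u'[OF x] in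
        \<open>auto intro!: derivative_eq_intros simp: power2_eq_square algebra_simps\<close>)
    finally show ?thesis .
  qed
  then have usol: "solution_on J (source_equation n A) u"
    using u by (simp add: solution_on_def source_equation_def)
  have "(deriv ^^ 2) v x = - source_coeff n A x * v x" if x: "x \<in> J" for x
  proof -
    have "(deriv ^^ 2) v x = deriv (\<lambda>x. a x * v x + u x / r x) x"
      unfolding numeral_2_eq_2 funpow.simps comp_apply id_apply
      by (rule deriv_eq_on_open[OF opn x]) (rule DERIV_imp_deriv[OF v'])
    also have "\<dots> = - source_coeff n A x * v x"
    proof (rule DERIV_imp_deriv)
      have r': "deriv r x = 2 * a x * r x" using r0[OF x] by (simp add: a_def)
      show "((\<lambda>x. a x * v x + u x / r x) has_real_derivative - source_coeff n A x * v x) (at x)"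
        using a'[OF x] u'[OF x] v'[OF x] smooth_on_DERIV[OF r x] r0[OF x]
        by (auto intro!: derivative_eq_intros simp: r' power2_eq_square field_simps)
    qed
    finally show ?thesis .
  qed
  then have vsol: "solution_on J (source_equation n A) v"
    using v by (simp add: solution_on_def source_equation_def)
  have inj: "inj_on T J" by (rule inj_on_open_interval[OF J T(1)]) (use r0 in auto)
  note indep = lin_indep_on_gauged_powers[OF open_interval_infinite[OF J] inj]
  have form: "u x ^ (n - 1 - k) * v x ^ k = u x ^ (n - 1) * T x ^ k" if "k < n" for k x
    using that by (simp add: v_def power_mult_distrib flip: power_add mult.assoc)
  have "solution_on J (normal_form n A) (\<lambda>x. u x ^ (n - 1) * (T x - 0) ^ k)" if k: "k < n" for k
  proof -
    have sm: "smooth_on J (\<lambda>x. u x ^ (n - 1) * (T x - 0) ^ k)"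
      using opn u T(2) by (intro smooth_on_intros)
    have "(Psi r s ^^ n) (\<lambda>x. u x ^ (n - 1) * (T x - 0) ^ k) x
        = u x ^ (n - 1) * (\<Prod>i<n. real k - real i) * (T x - 0) ^ (k - n)" if x: "x \<in> J" for x
    proof (rule Psi_funpow_gauged_power[OF opn _ _ T(1) _ x])
      fix z assume z: "z \<in> J"
      show "((\<lambda>x. u x ^ (n - 1)) has_real_derivative (real n - 1) * a z * u z ^ (n - 1)) (at z)"
        using DERIV_power_Suc[OF u'[OF z], of "n - 2"] n
        by (simp add: algebra_simps flip: power_Suc) (simp add: Suc_diff_Suc numeral_2_eq_2)
      show "r z * ((real n - 1) * a z * u z ^ (n - 1)) + s z * u z ^ (n - 1) = 0"
        unfolding s_eq[OF z] a_def using r0[OF z] by (simp add: field_simps)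
    qed (use r0 in auto)
    then have "c x * normal_form n A (\<lambda>x. u x ^ (n - 1) * (T x - 0) ^ k) x = 0" if "x \<in> J" for x
      using eq[OF sm that] ffact_zero[OF k] that by simp
    then show ?thesis using sm c0 by (simp add: solution_on_def)
  qed
  then have "\<forall>k<n. solution_on J (normal_form n A) (\<lambda>x. u x ^ (n - 1 - k) * v x ^ k)"
    by (auto simp only: form diff_zero)
  moreover have "lin_indep_on J n (\<lambda>k x. u x ^ (n - 1 - k) * v x ^ k)"
    by (rule indep[of "\<lambda>x. u x ^ (n - 1)"]) (use u0 form in auto)
  moreover have "lin_indep_on J 2 (\<lambda>k. if k = 0 then u else v)"
    by (rule indep[of u]) (use u0 in \<open>auto simp: v_def less_2_cases_iff\<close>)
  ultimately show ?thesis
    unfolding has_power_solutions_on_def using usol vsol by blast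
qed

section \<open>Equations with power solutions are iterative\<close>

text \<open>
  The shift \<open>\<tau>\<close> is arbitrary so that, at every point \<open>x\<close>, the choice \<open>\<tau> = t x\<close> provides solutions whose
  images under the powers of \<open>Psi r s\<close> vanish at \<open>x\<close> except for a single power.
\<close>

lemma iterative_if_gauged_power_solutions:
  assumes J: "open J" and r: "smooth_on J r" and s: "smooth_on J s"
    and r0: "\<And>x. x \<in> J \<Longrightarrow> r x \<noteq> 0"
    and \<phi>: "\<And>x. x \<in> J \<Longrightarrow> (\<phi> has_real_derivative \<phi>' x) (at x)"
      "\<And>x. x \<in> J \<Longrightarrow> r x * \<phi>' x + s x * \<phi> x = 0" "\<And>x. x \<in> J \<Longrightarrow> \<phi> x \<noteq> 0"
    and t: "\<And>x. x \<in> J \<Longrightarrow> (t has_real_derivative 1 / r x) (at x)"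
    and sol: "\<And>k \<tau>. k < n \<Longrightarrow> solution_on J (normal_form n A) (\<lambda>x. \<phi> x * (t x - \<tau>) ^ k)"
  shows "iterative_on J n (normal_form n A)"
proof -
  let ?\<rho> = "\<lambda>x. 1 / r x" and ?\<sigma> = "\<lambda>x. - s x / r x"
  let ?K = "expansion_coeff r ?\<rho> ?\<sigma>"
  define B where "B j x = ?K n j x + (\<Sum>i=2..n. A i x * ?K (n - i) j x)" for j x
  have sm: "smooth_on J ?\<rho>" "smooth_on J ?\<sigma>"
    using smooth_on_divide[OF J smooth_on_const r r0]
      smooth_on_divide[OF J smooth_on_mult[OF J smooth_on_const s] r r0, of "-1"] by auto
  have expand: "normal_form n A y x = (\<Sum>j\<le>n. B j x * (Psi r s ^^ j) y x)"
    if y: "smooth_on J y" and x: "x \<in> J" for y x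
  proof -
    have d: "(deriv ^^ m) y x = (\<Sum>j\<le>n. ?K m j x * (Psi r s ^^ j) y x)" if "m \<le> n" for m
    proof -
      have "(deriv ^^ m) y x = (\<Sum>j\<le>m. ?K m j x * (Psi r s ^^ j) y x)"
        unfolding deriv_eq_Psi
        by (rule Psi_funpow_expansion[OF J r s sm _ _ y x]) (use r0 in auto)
      also have "\<dots> = (\<Sum>j\<le>n. ?K m j x * (Psi r s ^^ j) y x)"
        by (rule sum.mono_neutral_left) (use that in \<open>auto simp: expansion_coeff_eq_0\<close>)
      finally show ?thesis .
    qed
    have "(\<Sum>i=2..n. A i x * (deriv ^^ (n - i)) y x)
        = (\<Sum>i=2..n. \<Sum>j\<le>n. A i x * ?K (n - i) j x * (Psi r s ^^ j) y x)"
      by (rule sum.cong) (simp_all add: d sum_distrib_left mult.assoc)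
    also have "\<dots> = (\<Sum>j\<le>n. (\<Sum>i=2..n. A i x * ?K (n - i) j x) * (Psi r s ^^ j) y x)"
      by (subst sum.swap) (simp add: sum_distrib_right)
    finally show ?thesis
      unfolding normal_form_def B_def by (simp add: d sum.distrib distrib_right)
  qed
  have B0: "B k x = 0" if k: "k < n" and x: "x \<in> J" for k x
  proof -
    let ?y = "\<lambda>z. \<phi> z * (t z - t x) ^ k"
    have y: "smooth_on J ?y" "normal_form n A ?y x = 0"
      using sol[OF k, of "t x"] x by (auto simp: solution_on_def)
    have "(Psi r s ^^ j) ?y x = (if j = k then \<phi> x * (\<Prod>i<k. real k - real i) else 0)" for j
    proof -
      have "(Psi r s ^^ j) ?y x = \<phi> x * (\<Prod>i<j. real k - real i) * (t x - t x) ^ (k - j)"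
        by (rule Psi_funpow_gauged_power[OF J \<phi>(1,2) t _ x]) (use r0 in auto)
      then show ?thesis using ffact_zero[of k j] by (cases j k rule: linorder_cases) auto
    qed
    then have "normal_form n A ?y x
        = (\<Sum>j\<le>n. if j = k then B j x * (\<phi> x * (\<Prod>i<k. real k - real i)) else 0)"
      unfolding expand[OF y(1) x] by (intro sum.cong) auto
    also have "\<dots> = B k x * (\<phi> x * (\<Prod>i<k. real k - real i))"
      using k by simp
    finally show ?thesis using y(2) \<phi>(3)[OF x] ffact_nonzero[of k k] by simp
  qed
  have Bn: "B n x = 1 / r x ^ n" for x
  proof -
    have "(\<Sum>i=2..n. A i x * ?K (n - i) n x) = 0"
      by (rule sum.neutral) (auto simp: expansion_coeff_eq_0)
    then show ?thesis unfolding B_def by (simp add: expansion_coeff_diag power_one_over)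
  qed
  have "(Psi r s ^^ n) y x = r x ^ n * normal_form n A y x" if "smooth_on J y" "x \<in> J" for y x
  proof -
    have "normal_form n A y x = (\<Sum>j\<le>n. if j = n then B j x * (Psi r s ^^ j) y x else 0)"
      unfolding expand[OF that] by (rule sum.cong) (use B0 that in auto)
    then show ?thesis using Bn r0[OF that(2)] by simp
  qed
  then have "same_equation_on J (Psi r s ^^ n) (normal_form n A)"
    unfolding same_equation_on_def using smooth_on_power[OF J r] r0
    by (intro exI[of _ "\<lambda>x. r x ^ n"]) auto
  then show ?thesis unfolding iterative_on_def using r s r0 by blast
qed

text \<open>
  The bounds provide a combination \<open>f\<close> of \<open>u\<close> and \<open>v\<close> without zeros, so that \<open>t = g/f\<close> and
  \<open>1/r = W/f\<^sup>2\<close> are smooth on the whole interval and not only near \<open>p\<close>.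
\<close>

lemma iterative_if_power_solutions:
  assumes n: "2 \<le> n" and J: "open_interval J" and p: "p \<in> J"
    and q: "\<And>x. x \<in> J \<Longrightarrow> \<bar>source_coeff n A x\<bar> \<le> K" and d: "\<And>x. x \<in> J \<Longrightarrow> \<bar>x - p\<bar> \<le> d"
    and Kd: "K * d\<^sup>2 \<le> 1 / 4"
    and pow: "has_power_solutions_on J n A"
  shows "iterative_on J n (normal_form n A)"
proof -
  have opn: "open J" using J by (simp add: open_interval_def)
  obtain u v where u: "solution_on J (source_equation n A) u"
    and v: "solution_on J (source_equation n A) v"
    and ind: "lin_indep_on J 2 (\<lambda>k. if k = 0 then u else v)"
    and sol: "\<And>k. k < n \<Longrightarrow> solution_on J (normal_form n A) (\<lambda>x. u x ^ (n - 1 - k) * v x ^ k)"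
    using pow unfolding has_power_solutions_on_def by blast
  have indep: "a = 0 \<and> b = 0" if "\<And>x. x \<in> J \<Longrightarrow> a * u x + b * v x = 0" for a b
  proof -
    have "\<forall>k<2::nat. (if k = 0 then a else b) = 0"
      using ind[unfolded lin_indep_on_def, rule_format, of "\<lambda>k. if k = 0 then a else b"] that
      by (simp add: numeral_2_eq_2)
    from this[rule_format, of 0] this[rule_format, of 1] show ?thesis by auto
  qed
  have sm: "smooth_on J u" "smooth_on J v" using u v by (auto simp: solution_on_def)
  have D: "(w has_real_derivative deriv w x) (at x)"
    "(deriv w has_real_derivative - source_coeff n A x * w x) (at x)"
    if w: "solution_on J (source_equation n A) w" and x: "x \<in> J" for w x
  proof -
    have sw: "smooth_on J w" using w by (simp add: solution_on_def)
    show "(w has_real_derivative deriv w x) (at x)" by (rule smooth_on_DERIV[OF sw x])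
    have "deriv (deriv w) x = - source_coeff n A x * w x"
      using w x by (auto simp: solution_on_def source_equation_def numeral_2_eq_2 add_eq_0_iff)
    then show "(deriv w has_real_derivative - source_coeff n A x * w x) (at x)"
      using smooth_on_DERIV[OF smooth_on_deriv[OF sw] x] by simp
  qed
  obtain a b where ab: "a \<noteq> 0 \<or> b \<noteq> 0" "a * deriv u p + b * deriv v p = 0"
  proof (cases "deriv v p = 0 \<and> deriv u p = 0")
    case True
    then show ?thesis using that[of 1 0] by simp
  next
    case False
    then show ?thesis using that[of "deriv v p" "- deriv u p"] by auto
  qed
  define f where "f = (\<lambda>x. a * u x + b * v x)"
  define f' where "f' = (\<lambda>x. a * deriv u x + b * deriv v x)"
  \<comment> \<open>The coefficient vector of \<open>g\<close> is orthogonal to that of \<open>f\<close>, hence never proportional to it.\<close>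
  define g where "g = (\<lambda>x. - b * u x + a * v x)"
  define g' where "g' = (\<lambda>x. - b * deriv u x + a * deriv v x)"
  have f': "(f has_real_derivative f' x) (at x)"
    "(f' has_real_derivative - source_coeff n A x * f x) (at x)" if x: "x \<in> J" for x
    unfolding f_def f'_def using D[OF u x] D[OF v x]
    by (auto intro!: derivative_eq_intros simp: algebra_simps)
  have g': "(g has_real_derivative g' x) (at x)"
    "(g' has_real_derivative - source_coeff n A x * g x) (at x)" if x: "x \<in> J" for x
    unfolding g_def g'_def using D[OF u x] D[OF v x]
    by (auto intro!: derivative_eq_intros simp: algebra_simps)
  have smf: "smooth_on J f" "smooth_on J f'"
    unfolding f_def f'_def using opn sm by (auto intro!: smooth_on_intros)
  have "f' p = 0" using ab by (simp add: f'_def)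
  note close = solution_close_to_initial_value[OF J p this f' q d Kd]
  have fp: "f p \<noteq> 0"
  proof
    assume "f p = 0"
    then have "a * u x + b * v x = 0" if "x \<in> J" for x
      using close[OF _ _ _ _ that] by (simp add: f_def)
    then show False using indep ab(1) by blast
  qed
  have f0: "f x \<noteq> 0" if "x \<in> J" for x using close[OF _ _ _ _ that] fp by auto
  have "((\<lambda>x. f x * g' x - f' x * g x) has_real_derivative 0) (at x)" if x: "x \<in> J" for x
    using f'[OF x] g'[OF x] by (auto intro!: derivative_eq_intros)
  then obtain W where W: "\<And>x. x \<in> J \<Longrightarrow> f x * g' x - f' x * g x = W"
    using constant_on_open_interval[OF J, of "\<lambda>x. f x * g' x - f' x * g x"] by blast
  define t where "t = (\<lambda>x. g x / f x)"
  have t': "(t has_real_derivative W / (f x)\<^sup>2) (at x)" if x: "x \<in> J" for x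
    unfolding t_def W[OF x, symmetric] using f'(1)[OF x] g'(1)[OF x] f0[OF x]
    by (auto intro!: derivative_eq_intros simp: power2_eq_square algebra_simps)
  have "W \<noteq> 0"
  proof
    assume "W = 0"
    then have "(t has_real_derivative 0) (at x)" if "x \<in> J" for x using t'[OF that] by simp
    then obtain c where c: "\<And>x. x \<in> J \<Longrightarrow> t x = c"
      using constant_on_open_interval[OF J, of t] by blast
    have "(- b - c * a) * u x + (a - c * b) * v x = 0" if "x \<in> J" for x
      using c[OF that] f0[OF that] unfolding t_def by (simp add: f_def g_def field_simps)
    then have "- b - c * a = 0" "a - c * b = 0" using indep by blast+
    then have "a\<^sup>2 + b\<^sup>2 = 0" by algebra
    then show False using ab(1) by (simp add: sum_power2_eq_zero_iff)
  qed
  define r where "r = (\<lambda>x. 1 / W * f x ^ 2)"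
  define s where "s = (\<lambda>x. - (real n - 1) / W * (f x * f' x))"
  show ?thesis
  proof (rule iterative_if_gauged_power_solutions[OF opn, where r = r and s = s and t = t
        and \<phi> = "\<lambda>x. f x ^ (n - 1)" and \<phi>' = "\<lambda>x. (real n - 1) * (f' x * f x ^ (n - 2))"])
    show "smooth_on J r" unfolding r_def using opn smf by (intro smooth_on_intros)
    show "smooth_on J s" unfolding s_def using opn smf by (intro smooth_on_intros)
    fix x assume x: "x \<in> J"
    show "r x \<noteq> 0" "f x ^ (n - 1) \<noteq> 0" using f0[OF x] \<open>W \<noteq> 0\<close> by (auto simp: r_def)
    show "(t has_real_derivative 1 / r x) (at x)" using t'[OF x] by (simp add: r_def)
    have n': "n - 1 = Suc (n - 2)" "1 + real (n - 2) = real n - 1" using n by auto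
    show "((\<lambda>x. f x ^ (n - 1)) has_real_derivative (real n - 1) * (f' x * f x ^ (n - 2))) (at x)"
      using DERIV_power_Suc[OF f'(1)[OF x], of "n - 2"] unfolding n' by simp
    show "r x * ((real n - 1) * (f' x * f x ^ (n - 2))) + s x * f x ^ (n - 1) = 0"
      unfolding r_def s_def n'
      by (simp add: power2_eq_square algebra_simps diff_divide_distrib)
  next
    fix k \<tau> assume k: "k < n"
    have "solution_on J (normal_form n A) (\<lambda>x. u x ^ i * v x ^ j)" if "i + j = n - 1" for i j
    proof -
      have "j < n" "n - 1 - j = i" using that n by auto
      then show ?thesis using sol[of j] by simp
    qed
    then have "solution_on J (normal_form n A)
        (\<lambda>x. (a * u x + b * v x) ^ (n - 1 - k) * ((- b - \<tau> * a) * u x + (a - \<tau> * b) * v x) ^ k)"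
      by (rule solution_on_binary_forms[OF opn]) (use k in auto)
    then show "solution_on J (normal_form n A) (\<lambda>x. f x ^ (n - 1) * (t x - \<tau>) ^ k)"
    proof (rule solution_on_cong[OF opn])
      fix x assume x: "x \<in> J"
      have "(- b - \<tau> * a) * u x + (a - \<tau> * b) * v x = f x * (t x - \<tau>)"
        using f0[OF x] unfolding t_def
        by (simp add: right_diff_distrib) (simp add: f_def g_def algebra_simps)
      moreover have "f x ^ (n - 1) = f x ^ (n - 1 - k) * f x ^ k"
        using k by (simp flip: power_add)
      ultimately show "(a * u x + b * v x) ^ (n - 1 - k)
          * ((- b - \<tau> * a) * u x + (a - \<tau> * b) * v x) ^ k = f x ^ (n - 1) * (t x - \<tau>) ^ k"
        by (simp add: f_def power_mult_distrib)
    qed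
  qed
qed

section \<open>The equivalence near a point\<close>

theorem theorem2:
  fixes n :: nat and A :: "nat \<Rightarrow> real \<Rightarrow> real" and I :: "real set" and x0 :: real
  assumes "2 \<le> n"
    and "open_interval I"
    and "\<And>j. 2 \<le> j \<Longrightarrow> j \<le> n \<Longrightarrow> smooth_on I (A j)"
    and "x0 \<in> I"
  shows "\<exists>J0. open_interval J0 \<and> x0 \<in> J0 \<and> J0 \<subseteq> I \<and>
           (\<forall>J. open_interval J \<and> x0 \<in> J \<and> J \<subseteq> J0 \<longrightarrow>
              (iterative_on J n (normal_form n A) \<longleftrightarrow> has_power_solutions_on J n A))"
proof -
  let ?q = "source_coeff n A"
  have "open I" using assms(2) by (simp add: open_interval_def)
  have "isCont (A 2) x0"
    using smooth_on_DERIV[OF assms(3)[OF order_refl assms(1)] assms(4)] by (rule DERIV_isCont)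
  then have "isCont ?q x0" unfolding source_coeff_def by (intro continuous_intros) (use assms(1) in auto)
  then have "\<forall>\<^sub>F x in at x0. dist (?q x) (?q x0) < 1"
    by (simp add: isCont_def tendstoD)
  then obtain e where e: "e > 0" "\<And>x. x \<noteq> x0 \<Longrightarrow> dist x x0 < e \<Longrightarrow> dist (?q x) (?q x0) < 1"
    unfolding eventually_at by auto
  obtain e' where e': "e' > 0" "ball x0 e' \<subseteq> I"
    using \<open>open I\<close> assms(4) open_contains_ball by blast
  define K where "K = \<bar>?q x0\<bar> + 1"
  \<comment> \<open>The bound \<open>K\<close> is at least 1, so that \<open>K * d\<^sup>2 \<le> 1/(4K) \<le> 1/4\<close> for this \<open>d\<close>.\<close>
  define d where "d = min (min e e') (1 / (2 * K))"
  have K: "K \<ge> 1" by (simp add: K_def)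
  have d0: "d > 0" using e e' K by (simp add: d_def)
  have "d \<le> 1 / (2 * K)" by (simp add: d_def)
  then have "d\<^sup>2 \<le> (1 / (2 * K))\<^sup>2" using d0 by (intro power_mono) auto
  then have "K * d\<^sup>2 \<le> K * (1 / (2 * K))\<^sup>2" using K by (intro mult_left_mono) auto
  also have "\<dots> = 1 / (4 * K)" using K by (simp add: power2_eq_square field_simps)
  also have "\<dots> \<le> 1 / 4" using K by (simp add: field_simps)
  finally have Kd: "K * d\<^sup>2 \<le> 1 / 4" .
  have bound: "\<bar>?q x\<bar> \<le> K" if "x \<in> ball x0 d" for x
  proof -
    have "dist x x0 < e" using that by (simp add: d_def dist_commute)
    then have "\<bar>?q x - ?q x0\<bar> < 1"
      using e(2)[of x] by (cases "x = x0") (auto simp: dist_real_def)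
    then show ?thesis unfolding K_def by linarith
  qed
  show ?thesis
  proof (intro exI[of _ "ball x0 d"] conjI allI impI)
    show "open_interval (ball x0 d)"
      using d0 by (auto simp: open_interval_def is_interval_ball_real)
    show "x0 \<in> ball x0 d" using d0 by simp
    show "ball x0 d \<subseteq> I" using e'(2) by (auto simp: d_def)
    fix J assume J: "open_interval J \<and> x0 \<in> J \<and> J \<subseteq> ball x0 d"
    show "iterative_on J n (normal_form n A) \<longleftrightarrow> has_power_solutions_on J n A"
    proof
      show "has_power_solutions_on J n A" if "iterative_on J n (normal_form n A)"
        using power_solutions_if_iterative[OF assms(1) _ that] J by blast
      show "iterative_on J n (normal_form n A)" if "has_power_solutions_on J n A"
        by (rule iterative_if_power_solutions[OF assms(1) _ _ _ _ Kd that, of x0])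
           (use J bound in \<open>auto simp: subset_iff dist_real_def\<close>)
    qed
  qed
qed

end
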